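(* Let $H$ be an infinite-dimensional separable complex Hilbert space. Every self-adjoint operator $T\in\mathcal{B}(H)$ with finite spectrum belongs to $\mathcal{M}_r(H)$.
   Context: $\mathcal{B}(H)$ denotes the bounded linear operators on $H$. For a nonzero Hilbert space $M$ and $A\in\mathcal{B}(M)$, the minimum modulus is $m(A)=\inf\{\|Ax\|: x\in M,\ \|x\|=1\}$; $A$ is minimum attaining if there is a unit vector $x_0\in M$ with $\|Ax_0\|=m(A)$. A closed subspace $M\subseteq H$ reduces $T\in\mathcal{B}(H)$ if $T(M)\subseteq M$ and $T^*(M)\subseteq M$. $\mathcal{M}_r(H)$ is the set of all $T\in\mathcal{B}(H)$ such that for every nonzero closed subspace $M$ reducing $T$, the restriction $T|_M:M\to M$ is minimum attaining. *)

theory Defs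
  imports "HOL-Analysis.Analysis"
begin

section \<open>Complex Hilbert spaces\<close>

class scaleC =
  fixes scaleC :: "complex \<Rightarrow> 'a \<Rightarrow> 'a"  (infixr "*\<^sub>C" 75)

text \<open>The inner product is linear in the first argument. Norm, metric and topology are those of
  the underlying \<^class>\<open>real_normed_vector\<close>, tied to the inner product by \<open>norm_eq_sqrt_cinner\<close>.\<close>

class complex_inner = real_normed_vector + scaleC +
  fixes cinner :: "'a \<Rightarrow> 'a \<Rightarrow> complex"
  assumes scaleC_add_right: "c *\<^sub>C (x + y) = c *\<^sub>C x + c *\<^sub>C y"
    and scaleC_add_left: "(c + d) *\<^sub>C x = c *\<^sub>C x + d *\<^sub>C x"
    and scaleC_scaleC: "c *\<^sub>C (d *\<^sub>C x) = (c * d) *\<^sub>C x"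
    and scaleC_of_real: "complex_of_real r *\<^sub>C x = r *\<^sub>R x"
    and cinner_commute: "cinner x y = cnj (cinner y x)"
    and cinner_add_left: "cinner (x + y) z = cinner x z + cinner y z"
    and cinner_scaleC_left: "cinner (c *\<^sub>C x) y = c * cinner x y"
    and cinner_ge_zero: "0 \<le> Re (cinner x x)"
    and cinner_eq_zero_iff: "cinner x x = 0 \<longleftrightarrow> x = 0"
    and norm_eq_sqrt_cinner: "norm x = sqrt (Re (cinner x x))"

class complex_hilbert = complex_inner + complete_space

lemma scaleC_one: "1 *\<^sub>C x = (x :: 'a::complex_inner)"
  using scaleC_of_real[of 1 x] by simp

global_interpretation complex_vector: vector_space "scaleC :: complex \<Rightarrow> 'a \<Rightarrow> 'a::complex_inner"
  defines csubspace = complex_vector.subspace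
    and cspan = complex_vector.span
  by unfold_locales (simp_all add: scaleC_add_right scaleC_add_left scaleC_scaleC scaleC_one)

section \<open>Bounded operators\<close>

definition bounded_clinear :: "('a::complex_inner \<Rightarrow> 'b::complex_inner) \<Rightarrow> bool" where
  "bounded_clinear T \<longleftrightarrow> bounded_linear T \<and> (\<forall>c x. T (c *\<^sub>C x) = c *\<^sub>C T x)"

text \<open>\<open>cadjoint\<close> is only meaningful for bounded operators on a Hilbert space; there, existence and
  uniqueness are guaranteed by \<open>cadjoint_ex1\<close> below.\<close>

definition cadjoint :: "('a::complex_inner \<Rightarrow> 'a) \<Rightarrow> 'a \<Rightarrow> 'a" where
  "cadjoint T = (THE S. \<forall>x y. cinner (T x) y = cinner x (S y))"

definition selfadjoint :: "('a::complex_inner \<Rightarrow> 'a) \<Rightarrow> bool" where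
  "selfadjoint T \<longleftrightarrow> cadjoint T = T"

definition spectrum :: "('a::complex_inner \<Rightarrow> 'a) \<Rightarrow> complex set" where
  "spectrum T = {\<mu>. \<not> (\<exists>S. bounded_clinear S \<and>
     S \<circ> (\<lambda>x. T x - \<mu> *\<^sub>C x) = id \<and> (\<lambda>x. T x - \<mu> *\<^sub>C x) \<circ> S = id)}"

section \<open>Minimum modulus and reducing subspaces\<close>

text \<open>The operator \<open>A\<close> on a nonzero closed subspace \<open>M\<close> is represented by any function on the whole
  space that maps \<open>M\<close> to itself; only its values on \<open>M\<close> matter, so the restriction of \<open>T\<close> to \<open>M\<close>
  is \<open>T\<close> itself with \<open>M\<close> as carrier.\<close>

definition min_modulus_on :: "'a::complex_inner set \<Rightarrow> ('a \<Rightarrow> 'a) \<Rightarrow> real" where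
  "min_modulus_on M A = Inf {norm (A x) | x. x \<in> M \<and> norm x = 1}"

definition minimum_attaining_on :: "'a::complex_inner set \<Rightarrow> ('a \<Rightarrow> 'a) \<Rightarrow> bool" where
  "minimum_attaining_on M A \<longleftrightarrow> (\<exists>x0\<in>M. norm x0 = 1 \<and> norm (A x0) = min_modulus_on M A)"

definition reduces :: "'a::complex_inner set \<Rightarrow> ('a \<Rightarrow> 'a) \<Rightarrow> bool" where
  "reduces M T \<longleftrightarrow> csubspace M \<and> closed M \<and> T ` M \<subseteq> M \<and> cadjoint T ` M \<subseteq> M"

definition reducing_minimum_attaining :: "('a::complex_hilbert \<Rightarrow> 'a) set"  ("\<M>\<^sub>r") where
  "\<M>\<^sub>r = {T. bounded_clinear T \<and>
     (\<forall>M. reduces M T \<and> M \<noteq> {0} \<longrightarrow> minimum_attaining_on M T)}"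

section \<open>Existence and uniqueness of the adjoint\<close>

lemma cinner_add_right: "cinner x (y + z) = cinner x y + cinner x z"
  by (metis cinner_add_left cinner_commute complex_cnj_add)

lemma cinner_scaleC_right: "cinner x (c *\<^sub>C y) = cnj c * cinner x y"
  by (metis cinner_scaleC_left cinner_commute complex_cnj_mult)

lemma cinner_minus_left: "cinner (- x) y = - cinner x y"
proof -
  have "cinner (0 + 0) y = cinner 0 y + cinner 0 y" by (rule cinner_add_left)
  then have "cinner 0 y = 0" by simp
  then have "cinner x y + cinner (- x) y = 0" using cinner_add_left[of x "- x" y] by simp
  then show ?thesis by (rule minus_unique[symmetric])
qed

lemma cinner_minus_right: "cinner x (- y) = - cinner x y"
  by (metis cinner_minus_left cinner_commute complex_cnj_minus)

lemma cinner_diff_left: "cinner (x - y) z = cinner x z - cinner y z"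
  using cinner_add_left[of x "- y" z] by (simp add: cinner_minus_left)

lemma cinner_diff_right: "cinner x (y - z) = cinner x y - cinner x z"
  using cinner_add_right[of x y "- z"] by (simp add: cinner_minus_right)

lemma power2_norm_eq_cinner: "(norm x)\<^sup>2 = Re (cinner x x)"
  by (simp add: norm_eq_sqrt_cinner cinner_ge_zero)

lemma cinner_self: "cinner x x = complex_of_real ((norm x)\<^sup>2)"
proof (rule complex_eqI)
  have "Im (cinner x x) = Im (cnj (cinner x x))" by (subst cinner_commute) (rule refl)
  then show "Im (cinner x x) = Im (complex_of_real ((norm x)\<^sup>2))" by simp
qed (simp add: power2_norm_eq_cinner)

lemma cinner_parallelogram:
  fixes x y :: "'a::complex_inner"
  shows "(norm (x - y))\<^sup>2 + (norm (x + y))\<^sup>2 = 2 * (norm x)\<^sup>2 + 2 * (norm y)\<^sup>2"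
  by (simp add: power2_norm_eq_cinner cinner_add_left cinner_add_right cinner_diff_left cinner_diff_right)

lemma cinner_Cauchy_Schwarz:
  fixes x y :: "'a::complex_inner"
  shows "cmod (cinner x y) \<le> norm x * norm y"
proof (cases "y = 0")
  case True
  then show ?thesis using cinner_diff_right[of x 0 0] by simp
next
  case False
  define n where "n = (norm y)\<^sup>2"
  define a where "a = cinner x y"
  have n: "n > 0" using False by (simp add: n_def)
  have aa: "a * cnj a = complex_of_real ((cmod a)\<^sup>2)" by (rule complex_norm_square[symmetric])
  have yx: "cinner y x = cnj a" by (metis a_def cinner_commute)
  define w where "w = complex_of_real n *\<^sub>C x - a *\<^sub>C y"
  have "cinner w w = complex_of_real n * (complex_of_real n * cinner x x - a * cnj a)"
    unfolding w_def
    by (simp add: cinner_diff_left cinner_diff_right cinner_scaleC_left cinner_scaleC_right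
        a_def[symmetric] yx cinner_self[of y] n_def[symmetric])
  also have "\<dots> = complex_of_real (n * (n * (norm x)\<^sup>2 - (cmod a)\<^sup>2))"
    by (simp only: aa cinner_self of_real_mult of_real_diff)
  finally have "Re (cinner w w) = n * (n * (norm x)\<^sup>2 - (cmod a)\<^sup>2)"
    by (simp only: Re_complex_of_real)
  then have "0 \<le> n * (n * (norm x)\<^sup>2 - (cmod a)\<^sup>2)" using cinner_ge_zero[of w] by metis
  then have "0 \<le> n * (norm x)\<^sup>2 - (cmod a)\<^sup>2" using n by (meson leD mult_pos_neg not_le)
  then have "(cmod a)\<^sup>2 \<le> n * (norm x)\<^sup>2" by simp
  also have "\<dots> = (norm x * norm y)\<^sup>2" by (simp add: n_def power_mult_distrib)
  finally show ?thesis unfolding a_def by (rule power2_le_imp_le) simp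
qed

lemma min_norm_level_set:
  fixes f :: "'a::complex_hilbert \<Rightarrow> complex"
  assumes f: "bounded_linear f" and hom: "\<And>c x. f (c *\<^sub>C x) = c * f x" and e: "f e \<noteq> 0"
  obtains z where "f z = 1" "\<And>x. f x = 1 \<Longrightarrow> norm z \<le> norm x"
proof -
  interpret bounded_linear f by (rule f)
  define A where "A = {x. f x = 1}"
  define d where "d = Inf (norm ` A)"
  have "f (inverse (f e) *\<^sub>C e) = 1" using e by (simp add: hom)
  then have ne: "norm ` A \<noteq> {}" by (auto simp: A_def)
  have bdd: "bdd_below (norm ` A)" by (rule bdd_belowI2[of _ 0]) simp
  have d_le: "d \<le> norm x" if "x \<in> A" for x
    unfolding d_def using that bdd by (auto intro: cInf_lower)
  have d0: "0 \<le> d" unfolding d_def using ne by (intro cInf_greatest) auto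
  have "\<exists>x\<in>A. norm x < d + 1 / real (Suc n)" for n
    using cInf_lessD[OF ne, of "d + 1 / real (Suc n)"] unfolding d_def by auto
  then obtain X where X: "\<And>n. X n \<in> A" "\<And>n. norm (X n) < d + 1 / real (Suc n)" by metis
  have key: "(norm (X m - X n))\<^sup>2 \<le> 4 * ((d + 1 / real (Suc N))\<^sup>2 - d\<^sup>2)"
    if "N \<le> m" "N \<le> n" for m n N
  proof -
    have "f ((1/2) *\<^sub>R (X m + X n)) = 1" using X(1)[of m] X(1)[of n] by (simp add: A_def scaleR add scaleR_2[symmetric] scaleR_conv_of_real)
    then have "d \<le> norm ((1/2) *\<^sub>R (X m + X n))" by (intro d_le) (simp add: A_def)
    then have "2 * d \<le> norm (X m + X n)" by simp
    then have 1: "(2 * d)\<^sup>2 \<le> (norm (X m + X n))\<^sup>2" using d0 by (intro power_mono) auto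
    have 2: "(norm (X k))\<^sup>2 \<le> (d + 1 / real (Suc N))\<^sup>2" if "N \<le> k" for k
    proof (rule power_mono)
      have "1 / real (Suc k) \<le> 1 / real (Suc N)" using that by (simp add: frac_le)
      then show "norm (X k) \<le> d + 1 / real (Suc N)" using X(2)[of k] by linarith
    qed simp
    show ?thesis
      using cinner_parallelogram[of "X m" "X n"] 1 2[OF that(1)] 2[OF that(2)]
      by (simp add: power_mult_distrib)
  qed
  have lim: "(\<lambda>N. d + 1 / real (Suc N)) \<longlonglongrightarrow> d"
    using tendsto_add[OF tendsto_const[of d] LIMSEQ_inverse_real_of_nat] by (simp add: inverse_eq_divide)
  then have "(\<lambda>N. 4 * ((d + 1 / real (Suc N))\<^sup>2 - d\<^sup>2)) \<longlonglongrightarrow> 4 * (d\<^sup>2 - d\<^sup>2)"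
    by (intro tendsto_intros)
  then have lim0: "(\<lambda>N. 4 * ((d + 1 / real (Suc N))\<^sup>2 - d\<^sup>2)) \<longlonglongrightarrow> 0" by simp
  have "Cauchy X"
  proof (rule metric_CauchyI)
    fix \<epsilon> :: real assume "\<epsilon> > 0"
    then have "eventually (\<lambda>N. 4 * ((d + 1 / real (Suc N))\<^sup>2 - d\<^sup>2) < \<epsilon>\<^sup>2) sequentially"
      using order_tendstoD(2)[OF lim0, of "\<epsilon>\<^sup>2"] by simp
    then obtain N where N: "4 * ((d + 1 / real (Suc N))\<^sup>2 - d\<^sup>2) < \<epsilon>\<^sup>2"
      by (auto simp: eventually_sequentially)
    have "dist (X m) (X n) < \<epsilon>" if "N \<le> m" "N \<le> n" for m n
      using key[OF that] N \<open>\<epsilon> > 0\<close> by (auto simp: dist_norm intro!: power2_less_imp_less[of _ \<epsilon>])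
    then show "\<exists>N. \<forall>m\<ge>N. \<forall>n\<ge>N. dist (X m) (X n) < \<epsilon>" by blast
  qed
  then obtain z where z: "X \<longlonglongrightarrow> z" using Cauchy_convergent convergent_def by blast
  have "(\<lambda>n. f (X n)) \<longlonglongrightarrow> f z" using z by (rule tendsto)
  moreover have "(\<lambda>n. f (X n)) = (\<lambda>n. 1)" using X(1) by (simp add: A_def)
  ultimately have "f z = 1" by (simp add: LIMSEQ_const_iff)
  moreover have "norm z \<le> d"
    by (rule LIMSEQ_le[OF tendsto_norm[OF z] lim]) (blast intro: less_imp_le X(2))
  then have "norm z \<le> norm x" if "f x = 1" for x
    using d_le[of x] that by (simp add: A_def)
  ultimately show ?thesis using that by blast
qed

lemma riesz_representation:
  fixes f :: "'a::complex_hilbert \<Rightarrow> complex"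
  assumes f: "bounded_linear f" and hom: "\<And>c x. f (c *\<^sub>C x) = c * f x"
  shows "\<exists>z. \<forall>x. f x = cinner x z"
proof (cases "\<forall>x. f x = 0")
  case True
  have "cinner x 0 = 0" for x :: 'a using cinner_diff_right[of x 0 0] by simp
  with True show ?thesis by metis
next
  case False
  interpret bounded_linear f by (rule f)
  obtain e where "f e \<noteq> 0" using False by blast
  then obtain z where z: "f z = 1" and z_min: "\<And>x. f x = 1 \<Longrightarrow> norm z \<le> norm x"
    using min_norm_level_set[OF f hom] by blast
  have "z \<noteq> 0" using z zero by auto
  have orth: "cinner v z = 0" if v: "f v = 0" for v
  proof (cases "v = 0")
    case True
    then show ?thesis using cinner_diff_left[of 0 0 z] by simp
  next
    case False
    define n where "n = (norm v)\<^sup>2"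
    define a where "a = cinner z v"
    have n: "n > 0" using False by (simp add: n_def)
    have aa: "a * cnj a = complex_of_real ((cmod a)\<^sup>2)" by (rule complex_norm_square[symmetric])
    have vz: "cinner v z = cnj a" by (metis a_def cinner_commute)
    define c where "c = a / complex_of_real n"
    have "f (z - c *\<^sub>C v) = 1" by (simp add: diff hom v z)
    then have "(norm z)\<^sup>2 \<le> (norm (z - c *\<^sub>C v))\<^sup>2" using z_min by (intro power_mono) auto
    also have "\<dots> = (norm z)\<^sup>2 - (cmod a)\<^sup>2 / n"
    proof -
      have "cinner (z - c *\<^sub>C v) (z - c *\<^sub>C v) = cinner z z - a * cnj a / complex_of_real n"
        using n
        by (simp add: cinner_diff_left cinner_diff_right cinner_scaleC_left cinner_scaleC_right
            a_def[symmetric] vz cinner_self[of v] n_def[symmetric] c_def del: of_real_power)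
      also have "\<dots> = complex_of_real ((norm z)\<^sup>2 - (cmod a)\<^sup>2 / n)"
        by (simp only: aa cinner_self of_real_diff of_real_divide)
      finally show ?thesis by (simp only: power2_norm_eq_cinner Re_complex_of_real)
    qed
    finally have "(cmod a)\<^sup>2 \<le> 0" using n by (simp add: field_simps)
    then show ?thesis using vz by simp
  qed
  have "f x = cinner x (complex_of_real (1 / (norm z)\<^sup>2) *\<^sub>C z)" for x
  proof -
    have "cinner (x - f x *\<^sub>C z) z = 0" by (rule orth) (simp add: diff hom z)
    then have "cinner x z = f x * complex_of_real ((norm z)\<^sup>2)"
      by (simp add: cinner_diff_left cinner_scaleC_left cinner_self)
    then show ?thesis using \<open>z \<noteq> 0\<close> by (simp add: cinner_scaleC_right field_simps)
  qed
  then show ?thesis by blast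
qed

lemma cadjoint_ex1:
  fixes T :: "'a::complex_hilbert \<Rightarrow> 'a"
  assumes "bounded_clinear T"
  shows "\<exists>!S. \<forall>x y. cinner (T x) y = cinner x (S y)"
proof -
  have T: "bounded_linear T" and TC: "\<And>c x. T (c *\<^sub>C x) = c *\<^sub>C T x"
    using assms by (auto simp: bounded_clinear_def)
  have "\<exists>z. \<forall>x. cinner (T x) y = cinner x z" for y
  proof (rule riesz_representation)
    have "bounded_linear (\<lambda>x. cinner x y)"
    proof (rule bounded_linear_intro)
      fix r and x :: 'a
      show "cinner (r *\<^sub>R x) y = r *\<^sub>R cinner x y"
        by (metis cinner_scaleC_left scaleC_of_real scaleR_conv_of_real)
    qed (auto simp: cinner_add_left intro: cinner_Cauchy_Schwarz)
    then show "bounded_linear (\<lambda>x. cinner (T x) y)" using T by (rule bounded_linear_compose)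
  qed (simp add: TC cinner_scaleC_left)
  then have "\<forall>y. \<exists>z. \<forall>x. cinner (T x) y = cinner x z" by blast
  from choice[OF this] obtain S where S: "\<forall>x y. cinner (T x) y = cinner x (S y)" by blast
  have "S' = S" if S': "\<forall>x y. cinner (T x) y = cinner x (S' y)" for S'
  proof
    fix y
    have "cinner x (S' y - S y) = 0" for x
      unfolding cinner_diff_right using S[rule_format, of x y] S'[rule_format, of x y] by simp
    from this[of "S' y - S y"] show "S' y = S y" by (simp add: cinner_eq_zero_iff)
  qed
  with S show ?thesis by blast
qed

lemma cadjoint_works:
  fixes T :: "'a::complex_hilbert \<Rightarrow> 'a"
  assumes "bounded_clinear T"
  shows "cinner (T x) y = cinner x (cadjoint T y)"
  using theI'[OF cadjoint_ex1[OF assms]] unfolding cadjoint_def by blast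

end

theory Submission
  imports Defs "HOL-Computational_Algebra.Fundamental_Theorem_Algebra"
begin

text \<open>A self-adjoint operator with finite spectrum is annihilated by a nonzero polynomial \<open>Q\<close>:
  choose \<open>Q\<close> vanishing on the spectrum with \<open>Q(T)\<close> symmetric and put \<open>s = onorm (Q(T))\<close>. Then
  \<open>Q(T)\<^sup>2 - s\<^sup>2\<close> is not bounded below, so it has a linear factor \<open>T - \<mu>\<close> with \<open>\<mu>\<close> in the spectrum,
  whence \<open>s\<^sup>2 = Q(\<mu>)\<^sup>2 = 0\<close>. On an invariant subspace \<open>M\<close> with minimum modulus \<open>m\<close>, the operator
  \<open>T\<^sup>2 - m\<^sup>2\<close> is positive but not bounded below, so neither is \<open>T - c\<close> with \<open>c\<close> one of \<open>m\<close>, \<open>-m\<close>. Such a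
  \<open>c\<close> is a root of the annihilating polynomial of least degree on \<open>M\<close>, hence an eigenvalue, and its
  eigenvectors attain \<open>m\<close>.\<close>

text \<open>The operator \<open>p(T)\<close>, evaluated by Horner's scheme.\<close>

definition poly_op :: "('a::complex_inner \<Rightarrow> 'a) \<Rightarrow> complex poly \<Rightarrow> 'a \<Rightarrow> 'a" where
  "poly_op T p = fold_coeffs (\<lambda>a S x. a *\<^sub>C x + T (S x)) p (\<lambda>_. 0)"

text \<open>For \<open>A = T - c\<close>, failure of this means that \<open>c\<close> is an
  approximate eigenvalue of \<open>T\<close> on \<open>M\<close>. Unlike invertibility, the property
  passes to subspaces directly.\<close>

definition bounded_below_on :: "'a::complex_inner set \<Rightarrow> ('a \<Rightarrow> 'a) \<Rightarrow> bool" where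
  "bounded_below_on M A \<longleftrightarrow> (\<exists>k>0. \<forall>x\<in>M. k * norm x \<le> norm (A x))"

lemma poly_op_0 [simp]: "poly_op T 0 x = 0"
  by (simp add: poly_op_def)

section \<open>Bounded operators and coercivity\<close>

lemma norm_scaleC: "norm (c *\<^sub>C x) = cmod c * norm (x :: 'a::complex_inner)"
proof (rule power2_eq_imp_eq)
  have "complex_of_real ((norm (c *\<^sub>C x))\<^sup>2) = (c * cnj c) * complex_of_real ((norm x)\<^sup>2)"
    by (metis cinner_self cinner_scaleC_left cinner_scaleC_right mult.assoc)
  also have "\<dots> = complex_of_real ((cmod c * norm x)\<^sup>2)"
    by (simp add: complex_norm_square[symmetric] power_mult_distrib)
  finally show "(norm (c *\<^sub>C x))\<^sup>2 = (cmod c * norm x)\<^sup>2"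
    using of_real_eq_iff by blast
qed simp_all

lemma bounded_clinear_compose:
  "bounded_clinear S \<Longrightarrow> bounded_clinear T \<Longrightarrow> bounded_clinear (\<lambda>x. S (T x))"
  by (simp add: bounded_clinear_def bounded_linear_compose)

lemma bounded_clinear_add:
  "bounded_clinear S \<Longrightarrow> bounded_clinear T \<Longrightarrow> bounded_clinear (\<lambda>x. S x + T x)"
  by (simp add: bounded_clinear_def bounded_linear_add scaleC_add_right)

lemma bounded_clinear_scaleC: "bounded_clinear (\<lambda>x :: 'a::complex_inner. c *\<^sub>C x)"
proof -
  have "bounded_linear (\<lambda>x :: 'a. c *\<^sub>C x)"
    by (rule bounded_linear_intro[of _ "cmod c"])
      (simp_all add: scaleC_add_right norm_scaleC mult.commute scaleC_scaleC flip: scaleC_of_real)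
  then show ?thesis by (simp add: bounded_clinear_def scaleC_scaleC mult.commute)
qed

lemma bounded_clinear_zero: "bounded_clinear (\<lambda>x. 0)"
  by (simp add: bounded_clinear_def bounded_linear_zero complex_vector.scale_zero_right)

text \<open>Positivity of \<open>R\<close> at \<open>x - t *\<^sub>R R x\<close> with \<open>t = 1 / K\<close>, where \<open>K\<close> bounds the norm of \<open>R\<close>,
  gives \<open>(norm (R x))\<^sup>2 \<le> K * Re (cinner (R x) x)\<close>.\<close>

lemma positive_bounded_below_coercive:
  fixes R :: "'a::complex_inner \<Rightarrow> 'a"
  assumes R: "bounded_linear R" and sym: "\<And>x y. cinner (R x) y = cinner x (R y)"
    and M: "csubspace M" and inv: "R ` M \<subseteq> M"
    and pos: "\<And>x. x \<in> M \<Longrightarrow> 0 \<le> Re (cinner (R x) x)"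
    and below: "bounded_below_on M R"
  obtains d where "d > 0" "\<And>x. x \<in> M \<Longrightarrow> d * (norm x)\<^sup>2 \<le> Re (cinner (R x) x)"
proof -
  interpret R: bounded_linear R by (rule R)
  obtain K where K: "K > 0" "\<And>x. norm (R x) \<le> norm x * K"
    using R.pos_bounded by blast
  obtain k where k: "k > 0" "\<And>x. x \<in> M \<Longrightarrow> k * norm x \<le> norm (R x)"
    using below by (auto simp: bounded_below_on_def)
  have "k\<^sup>2 / K * (norm x)\<^sup>2 \<le> Re (cinner (R x) x)" if x: "x \<in> M" for x
  proof -
    define t where "t = complex_of_real (1 / K)"
    have rt: "R (t *\<^sub>C y) = t *\<^sub>C R y" for y
      by (simp add: t_def R.scaleR scaleC_of_real del: of_real_divide)
    have ct: "cnj t = t" by (simp add: t_def)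
    have "x - t *\<^sub>C R x \<in> M"
      using M inv x by (intro complex_vector.subspace_diff complex_vector.subspace_scale) auto
    then have "0 \<le> Re (cinner (R (x - t *\<^sub>C R x)) (x - t *\<^sub>C R x))" by (rule pos)
    also have "cinner (R (x - t *\<^sub>C R x)) (x - t *\<^sub>C R x) =
        cinner (R x) x - 2 * t * cinner (R x) (R x) + t\<^sup>2 * cinner (R (R x)) (R x)"
      by (simp add: R.diff rt ct cinner_diff_left cinner_diff_right cinner_scaleC_left
          cinner_scaleC_right sym[of "R x" x] power2_eq_square algebra_simps)
    also have "Re \<dots> = Re (cinner (R x) x) - 2 / K * (norm (R x))\<^sup>2
        + (1 / K)\<^sup>2 * Re (cinner (R (R x)) (R x))"
      by (simp add: t_def cinner_self power2_eq_square)
    \<comment> \<open>With \<open>t = 1 / K\<close> the quadratic term is at most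
      \<open>(norm (R x))\<^sup>2 / K\<close>, half of the negative linear term, so a full
      \<open>1 / K\<close> survives.\<close>
    also have "Re (cinner (R (R x)) (R x)) \<le> K * (norm (R x))\<^sup>2"
    proof -
      have "Re (cinner (R (R x)) (R x)) \<le> norm (R (R x)) * norm (R x)"
        using complex_Re_le_cmod cinner_Cauchy_Schwarz order_trans by blast
      also have "\<dots> \<le> (norm (R x) * K) * norm (R x)"
        by (intro mult_right_mono K) simp
      finally show ?thesis by (simp add: power2_eq_square mult_ac)
    qed
    finally have "(norm (R x))\<^sup>2 \<le> K * Re (cinner (R x) x)"
      using K(1) by (simp add: power2_eq_square field_simps)
    moreover have "k\<^sup>2 * (norm x)\<^sup>2 \<le> (norm (R x))\<^sup>2"
      using power_mono[OF k(2)[OF x], of 2] k(1) by (simp add: power_mult_distrib)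
    ultimately show ?thesis using K(1) by (simp add: field_simps)
  qed
  with K(1) k(1) show ?thesis by (intro that[of "k\<^sup>2 / K"]) auto
qed

section \<open>Polynomials in a bounded operator\<close>

context
  fixes T :: "'a::complex_inner \<Rightarrow> 'a"
  assumes T: "bounded_clinear T"
begin

interpretation bounded_linear T
  using T by (simp add: bounded_clinear_def)

lemma poly_op_pCons [simp]: "poly_op T (pCons a p) x = a *\<^sub>C x + T (poly_op T p x)"
proof (cases "p = 0 \<and> a = 0")
  case True
  then show ?thesis by (simp add: zero complex_vector.scale_zero_left)
next
  case False
  then show ?thesis
    by (cases "p = 0") (simp_all add: poly_op_def fold_coeffs_pCons_not_0_0_eq)
qed

lemma poly_op_add: "poly_op T (p + q) x = poly_op T p x + poly_op T q x"
  by (induction p q rule: poly_induct2)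
    (simp_all add: add scaleC_add_left algebra_simps)

lemma poly_op_smult: "poly_op T (smult c p) x = c *\<^sub>C poly_op T p x"
  using T by (induction p)
    (simp_all add: bounded_clinear_def scaleC_add_right scaleC_scaleC complex_vector.scale_zero_right)

lemma poly_op_mult: "poly_op T (p * q) x = poly_op T p (poly_op T q x)"
  by (induction p) (simp_all add: poly_op_add poly_op_smult)

lemma poly_op_minus_const: "poly_op T (p - [:c:]) x = poly_op T p x - c *\<^sub>C x"
proof -
  have eq: "p - [:c:] = p + [:-c:]" by simp
  show ?thesis
    unfolding eq poly_op_add by (simp add: zero complex_vector.scale_minus_left)
qed

lemma bounded_clinear_poly_op: "bounded_clinear (poly_op T p)"
proof (induction p)
  case 0
  have eq: "poly_op T 0 = (\<lambda>_. 0)" by (rule ext) simp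
  show ?case unfolding eq by (rule bounded_clinear_zero)
next
  case (pCons a p)
  have eq: "poly_op T (pCons a p) = (\<lambda>x. a *\<^sub>C x + T (poly_op T p x))" by (rule ext) simp
  show ?case unfolding eq
    by (rule bounded_clinear_add[OF bounded_clinear_scaleC bounded_clinear_compose[OF T pCons.IH]])
qed

lemma poly_op_invariant:
  assumes "csubspace M" "T ` M \<subseteq> M" "x \<in> M"
  shows "poly_op T p x \<in> M"
  using assms by (induction p)
    (auto intro!: complex_vector.subspace_0 complex_vector.subspace_add complex_vector.subspace_scale)

lemma poly_op_adjoint:
  assumes sym: "\<And>x y. cinner (T x) y = cinner x (T y)"
  shows "cinner (poly_op T p x) y = cinner x (poly_op T (map_poly cnj p) y)"
proof (induction p arbitrary: x y)
  case 0
  show ?case using cinner_diff_left[of 0 0 y] cinner_diff_right[of x 0 0] by simp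
next
  case (pCons a p)
  \<comment> \<open>Symmetry moves \<open>T\<close> next to \<open>y\<close>, whereas Horner's
    scheme has it outermost.\<close>
  have "T (poly_op T q y) = poly_op T q (T y)" for q
    using T by (induction q) (simp_all add: zero add bounded_clinear_def)
  then show ?case using pCons
    by (simp add: map_poly_pCons cinner_add_left cinner_add_right cinner_scaleC_left
        cinner_scaleC_right sym)
qed

text \<open>Over the complex numbers \<open>p\<close> splits into linear factors, and lower bounds
  multiply under composition. Used contrapositively, it extracts an approximate eigenvalue among the
  roots of \<open>p\<close>.\<close>

lemma bounded_below_on_poly_op:
  assumes M: "csubspace M" "T ` M \<subseteq> M" and "p \<noteq> 0"
    and "\<And>c. poly p c = 0 \<Longrightarrow> bounded_below_on M (\<lambda>x. T x - c *\<^sub>C x)"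
  shows "bounded_below_on M (poly_op T p)"
  using assms(3,4)
proof (induction "degree p" arbitrary: p rule: less_induct)
  case less
  show ?case
  proof (cases "degree p = 0")
    case True
    then obtain a where p: "p = [:a:]" using degree_eq_zeroE by blast
    then have "a \<noteq> 0" using less.prems by auto
    with p show ?thesis
      by (auto simp: bounded_below_on_def zero norm_scaleC intro!: exI[of _ "cmod a"])
  next
    case False
    then obtain c where c: "poly p c = 0"
      using fundamental_theorem_of_algebra[of p] constant_degree[of p] by auto
    then obtain q where p: "p = [:-c,1:] * q" by (metis poly_eq_0_iff_dvd dvdE)
    then have "q \<noteq> 0" using less.prems by auto
    moreover from this have "degree q < degree p"
      unfolding p by (subst degree_mult_eq) auto
    ultimately have "bounded_below_on M (poly_op T q)"
      using less p by (intro less.hyps) auto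
    then obtain k where k: "k > 0" "\<And>x. x \<in> M \<Longrightarrow> k * norm x \<le> norm (poly_op T q x)"
      by (auto simp: bounded_below_on_def)
    obtain l where l: "l > 0" "\<And>x. x \<in> M \<Longrightarrow> l * norm x \<le> norm (T x - c *\<^sub>C x)"
      using less.prems(2)[OF c] by (auto simp: bounded_below_on_def)
    have "(l * k) * norm x \<le> norm (poly_op T p x)" if x: "x \<in> M" for x
    proof -
      have "(l * k) * norm x \<le> l * norm (poly_op T q x)"
        using k(2)[OF x] l(1) by (simp add: mult.assoc)
      also have "\<dots> \<le> norm (T (poly_op T q x) - c *\<^sub>C poly_op T q x)"
        \<comment> \<open>Invariance keeps \<open>poly_op T q x\<close> in \<open>M\<close>, where
          the bound for \<open>T - c\<close> holds.\<close>
        by (intro l poly_op_invariant M x)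
      also have "T (poly_op T q x) - c *\<^sub>C poly_op T q x = poly_op T p x"
        unfolding p by (subst poly_op_mult)
          (simp add: zero scaleC_one complex_vector.scale_minus_left)
      finally show ?thesis .
    qed
    then show ?thesis using k(1) l(1) unfolding bounded_below_on_def
      by (intro exI[of _ "l * k"]) auto
  qed
qed

section \<open>From finite spectrum to an annihilating polynomial\<close>

lemma bounded_below_on_not_in_spectrum:
  assumes "\<mu> \<notin> spectrum T"
  shows "bounded_below_on UNIV (\<lambda>x. T x - \<mu> *\<^sub>C x)"
proof -
  obtain S where S: "bounded_clinear S" "S \<circ> (\<lambda>x. T x - \<mu> *\<^sub>C x) = id"
    using assms by (auto simp: spectrum_def)
  obtain K where K: "K > 0" "\<And>x. norm (S x) \<le> norm x * K"
    using bounded_linear.pos_bounded[of S] S(1) by (auto simp: bounded_clinear_def)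
  have "inverse K * norm x \<le> norm (T x - \<mu> *\<^sub>C x)" for x
  proof -
    have "norm x = norm (S (T x - \<mu> *\<^sub>C x))" using fun_cong[OF S(2), of x] by simp
    also have "\<dots> \<le> norm (T x - \<mu> *\<^sub>C x) * K" by (rule K)
    finally show ?thesis using K(1) by (simp add: field_simps)
  qed
  then show ?thesis unfolding bounded_below_on_def
    using K(1) by (intro exI[of _ "inverse K"]) auto
qed

lemma finite_spectrum_imp_algebraic:
  assumes sym: "\<And>x y. cinner (T x) y = cinner x (T y)" and fin: "finite (spectrum T)"
  obtains Q where "Q \<noteq> 0" "\<And>x. poly_op T Q x = 0"
proof -
  define P where "P = (\<Prod>\<mu>\<in>spectrum T. [:-\<mu>, 1:])"
  \<comment> \<open>The conjugate factor makes the operator symmetric without knowing that the spectrum is real;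
    the factor \<open>[:0, 1:]\<close> keeps \<open>Q\<close> nonconstant if the spectrum is empty.\<close>
  define Q where "Q = [:0, 1:] * (P * map_poly cnj P)"
  have P: "P \<noteq> 0" using fin by (auto simp: P_def)
  then have P': "map_poly cnj P \<noteq> 0" by (simp add: map_poly_eq_0_iff)
  have Q0: "Q \<noteq> 0" using P P' by (auto simp: Q_def)
  have root: "poly Q \<mu> = 0" if "\<mu> \<in> spectrum T" for \<mu>
    using that fin by (auto simp: Q_def P_def poly_prod prod_zero_iff)
  have degQ: "degree Q > 0" using P P' unfolding Q_def by (subst degree_mult_eq) auto
  define S where "S = poly_op T Q"
  have Sb: "bounded_linear S"
    using bounded_clinear_poly_op[of Q] by (simp add: S_def bounded_clinear_def)
  interpret S: bounded_linear S by (rule Sb)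
  have cc: "map_poly cnj (map_poly cnj P) = P" by (simp add: map_poly_map_poly o_def)
  have Ssym: "cinner (S x) y = cinner x (S y)" for x y
  proof -
    have "map_poly cnj [:0, 1:] = [:0, 1:]" by (simp add: map_poly_pCons)
    then have "cinner (S x) y =
        cinner x (poly_op T P (poly_op T (map_poly cnj P) (poly_op T [:0,1:] y)))"
      unfolding S_def Q_def by (simp only: poly_op_mult poly_op_adjoint[OF sym] cc)
    also have "poly_op T P (poly_op T (map_poly cnj P) (poly_op T [:0,1:] y)) = S y"
      unfolding S_def Q_def by (simp only: poly_op_mult[symmetric] mult_ac)
    finally show ?thesis .
  qed
  define s where "s = onorm S"
  have s0: "s \<ge> 0" unfolding s_def by (rule onorm_pos_le[OF Sb])
  have Ss: "norm (S x) \<le> s * norm x" for x unfolding s_def by (rule onorm[OF Sb])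
  define q where "q = Q * Q - [:complex_of_real (s\<^sup>2):]"
  have "q \<noteq> 0"
  proof
    assume "q = 0"
    then have "Q * Q = [:complex_of_real (s\<^sup>2):]" by (simp add: q_def)
    then have "degree (Q * Q) = 0" by simp
    then show False using degQ Q0 by (simp add: degree_mult_eq)
  qed
  \<comment> \<open>The sign is opposite to \<open>q\<close>: the norm bound \<open>Ss\<close> makes
    this operator positive, and lower bounds ignore the sign.\<close>
  define R where "R x = s\<^sup>2 *\<^sub>R x - S (S x)" for x
  have qR: "poly_op T q x = - R x" for x
    unfolding q_def R_def poly_op_minus_const poly_op_mult S_def[symmetric] scaleC_of_real by simp
  have "s = 0"
  proof (rule ccontr)
    assume "s \<noteq> 0"
    then have s: "s > 0" using s0 by simp
    have "bounded_below_on UNIV (poly_op T q)"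
    proof (rule bounded_below_on_poly_op[OF _ _ \<open>q \<noteq> 0\<close>])
      fix c assume "poly q c = 0"
      \<comment> \<open>A root of \<open>q\<close> satisfies
        \<open>Q(c)\<^sup>2 = s\<^sup>2\<close>, which is nonzero, while \<open>Q\<close> vanishes
        on the spectrum.\<close>
      then have "poly Q c \<noteq> 0" using s by (auto simp: q_def)
      then show "bounded_below_on UNIV (\<lambda>x. T x - c *\<^sub>C x)"
        using root by (intro bounded_below_on_not_in_spectrum) auto
    qed (auto intro: complex_vector.subspace_UNIV)
    then have below: "bounded_below_on UNIV R" by (simp add: bounded_below_on_def qR)
    have Rq: "Re (cinner (R x) x) = s\<^sup>2 * (norm x)\<^sup>2 - (norm (S x))\<^sup>2" for x
      by (simp add: R_def cinner_diff_left Ssym[of "S x" x] cinner_self cinner_scaleC_left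
          flip: scaleC_of_real)
    have pos: "0 \<le> Re (cinner (R x) x)" for x
      unfolding Rq using power_mono[OF Ss[of x], of 2] by (simp add: power_mult_distrib)
    obtain d where d: "d > 0" "\<And>x. d * (norm x)\<^sup>2 \<le> Re (cinner (R x) x)"
    proof (rule positive_bounded_below_coercive[of R UNIV])
      show "bounded_linear R" unfolding R_def
        by (intro bounded_linear_sub bounded_linear_scaleR_right bounded_linear_compose[OF Sb Sb])
      show "cinner (R x) y = cinner x (R y)" for x y
        by (simp add: R_def cinner_diff_left cinner_diff_right Ssym cinner_scaleC_left
            cinner_scaleC_right flip: scaleC_of_real)
    qed (use pos below complex_vector.subspace_UNIV in auto)
    \<comment> \<open>Coercivity of \<open>R\<close> yields a bound for \<open>S\<close> strictly
      below its operator norm \<open>s\<close>. The \<open>max 0\<close> keeps \<open>s'\<close>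
      nonnegative, since \<open>sqrt\<close> of a negative number is negative.\<close>
    define s' where "s' = sqrt (max 0 (s\<^sup>2 - d))"
    have "norm (S x) \<le> s' * norm x" for x
    proof (rule power2_le_imp_le)
      have "(norm (S x))\<^sup>2 \<le> (s\<^sup>2 - d) * (norm x)\<^sup>2"
        using d(2)[of x] unfolding Rq by (simp add: algebra_simps)
      also have "\<dots> \<le> max 0 (s\<^sup>2 - d) * (norm x)\<^sup>2" by (intro mult_right_mono) auto
      finally show "(norm (S x))\<^sup>2 \<le> (s' * norm x)\<^sup>2"
        by (simp add: s'_def power_mult_distrib)
    qed (simp add: s'_def)
    then have "s \<le> s'" unfolding s_def by (intro onorm_bound) (auto simp: s'_def)
    moreover have "s' < s"
      unfolding s'_def using d(1) s by (intro real_less_lsqrt) auto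
    ultimately show False by simp
  qed
  then have "poly_op T Q x = 0" for x using Ss[of x] by (simp add: S_def)
  with Q0 that show ?thesis by blast
qed

section \<open>Attaining the minimum modulus on an invariant subspace\<close>

lemma algebraic_imp_minimum_attaining_on:
  assumes sym: "\<And>x y. cinner (T x) y = cinner x (T y)"
    and "Q0 \<noteq> 0" "\<And>x. poly_op T Q0 x = 0"
    and M: "csubspace M" and inv: "T ` M \<subseteq> M" and M0: "M \<noteq> {0}"
  shows "minimum_attaining_on M T"
proof -
  define m where "m = min_modulus_on M T"
  define A where "A = {norm (T x) | x. x \<in> M \<and> norm x = 1}"
  have m_Inf: "m = Inf A" by (simp add: m_def A_def min_modulus_on_def)
  have "0 \<in> M" using M by (rule complex_vector.subspace_0)
  have scale: "r *\<^sub>R x \<in> M" if "x \<in> M" for r x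
    using complex_vector.subspace_scale[OF M that, of "complex_of_real r"] by (simp add: scaleC_of_real)
  obtain u where u: "u \<in> M" "u \<noteq> 0" using M0 \<open>0 \<in> M\<close> by blast
  then have "norm (T (inverse (norm u) *\<^sub>R u)) \<in> A" unfolding A_def using scale by force
  then have A: "A \<noteq> {}" by blast
  have bdd: "bdd_below A" unfolding A_def by (rule bdd_belowI[of _ 0]) auto
  have m0: "m \<ge> 0" unfolding m_Inf by (rule cInf_greatest[OF A]) (auto simp: A_def)
  have m_le: "m * norm x \<le> norm (T x)" if "x \<in> M" for x
  proof (cases "x = 0")
    case False
    then have "norm (T (inverse (norm x) *\<^sub>R x)) \<in> A" unfolding A_def using scale that by force
    then have "m \<le> norm (T (inverse (norm x) *\<^sub>R x))" unfolding m_Inf by (intro cInf_lower bdd)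
    then show ?thesis using False by (simp add: scaleR field_simps)
  qed (simp add: zero)

  \<comment> \<open>The roots are \<open>m\<close> and \<open>-m\<close>. By symmetry the quadratic
    form of \<open>T\<^sup>2 - m\<^sup>2\<close> compares \<open>norm (T x)\<close> with
    \<open>m * norm x\<close>.\<close>
  define q where "q = [:- complex_of_real (m\<^sup>2), 0, 1:]"
  define R where "R = poly_op T q"
  have R_eq: "R x = T (T x) - m\<^sup>2 *\<^sub>R x" for x
    by (simp add: R_def q_def zero scaleC_one complex_vector.scale_zero_left
        complex_vector.scale_minus_left scaleC_of_real del: of_real_power)
  have Rq: "Re (cinner (R x) x) = (norm (T x))\<^sup>2 - m\<^sup>2 * (norm x)\<^sup>2" for x
    by (simp add: R_eq cinner_diff_left sym[of "T x" x] cinner_self cinner_scaleC_left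
        flip: scaleC_of_real)
  have "\<not> bounded_below_on M R"
  proof
    assume below: "bounded_below_on M R"
    have pos: "0 \<le> Re (cinner (R x) x)" if "x \<in> M" for x
      unfolding Rq using power_mono[OF m_le[OF that], of 2] m0 by (simp add: power_mult_distrib)
    obtain d where d: "d > 0" "\<And>x. x \<in> M \<Longrightarrow> d * (norm x)\<^sup>2 \<le> Re (cinner (R x) x)"
    proof (rule positive_bounded_below_coercive[of R M])
      show "bounded_linear R"
        using bounded_clinear_poly_op by (simp add: R_def bounded_clinear_def)
      show "cinner (R x) y = cinner x (R y)" for x y
        by (simp add: R_eq cinner_diff_left cinner_diff_right sym cinner_scaleC_left
            cinner_scaleC_right flip: scaleC_of_real)
      show "R ` M \<subseteq> M" unfolding R_def using poly_op_invariant[OF M inv] by blast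
    qed (use pos below M in auto)
    \<comment> \<open>Coercivity would raise the lower bound on unit vectors above their infimum
      \<open>m\<close>.\<close>
    have "sqrt (m\<^sup>2 + d) \<le> y" if "y \<in> A" for y
    proof -
      obtain x where x: "x \<in> M" "norm x = 1" "y = norm (T x)" using \<open>y \<in> A\<close> by (auto simp: A_def)
      have "m\<^sup>2 + d \<le> y\<^sup>2" using d(2)[OF x(1)] by (simp add: Rq x)
      then show ?thesis using x(3) by (intro real_le_lsqrt) auto
    qed
    then have "sqrt (m\<^sup>2 + d) \<le> m" unfolding m_Inf by (intro cInf_greatest[OF A])
    then have "m\<^sup>2 + d \<le> m\<^sup>2" by (rule sqrt_le_D)
    then show False using d(1) by simp
  qed
  moreover have "q \<noteq> 0" by (simp add: q_def)
  ultimately obtain c where c: "poly q c = 0" and nb: "\<not> bounded_below_on M (\<lambda>x. T x - c *\<^sub>C x)"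
    using bounded_below_on_poly_op[OF M inv, of q] unfolding R_def by blast
  \<comment> \<open>The modulus suffices: an eigenvector \<open>y\<close> for \<open>c\<close> has
    \<open>norm (T y) = m * norm y\<close>.\<close>
  have cm: "cmod c = m"
  proof -
    have "c\<^sup>2 = complex_of_real (m\<^sup>2)" using c by (simp add: q_def power2_eq_square algebra_simps)
    then have "(cmod c)\<^sup>2 = m\<^sup>2" by (metis norm_of_real norm_power abs_power2 power2_abs)
    then show ?thesis using m0 by (simp add: power2_eq_iff_nonneg)
  qed

  \<comment> \<open>Annihilation is tested on \<open>M\<close> alone, so that a polynomial of lower
    degree than the minimal one fails at a vector of \<open>M\<close>.\<close>
  define ann where "ann Q \<longleftrightarrow> Q \<noteq> 0 \<and> (\<forall>x\<in>M. poly_op T Q x = 0)" for Q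
  define Q where "Q = arg_min degree ann"
  have "ann Q0" using assms by (simp add: ann_def)
  then have Q: "ann Q" and Qmin: "\<And>P. ann P \<Longrightarrow> degree Q \<le> degree P"
    unfolding Q_def by (auto intro: arg_min_natI arg_min_nat_le)
  have "poly Q c = 0"
  proof (rule ccontr)
    assume Qc: "poly Q c \<noteq> 0"
    \<comment> \<open>Since \<open>Q(T)\<close> vanishes on \<open>M\<close>, this division writes
      \<open>- Q(c) x\<close> as \<open>G(T)\<close> applied to \<open>(T - c) x\<close>;
      boundedness of \<open>G(T)\<close> then bounds \<open>T - c\<close> from below on
      \<open>M\<close>.\<close>
    obtain G where G: "Q - [:poly Q c:] = G * [:-c, 1:]"
      by (metis poly_eq_0_iff_dvd dvdE mult.commute poly_diff poly_const_conv diff_self)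
    obtain K where K: "K > 0" "\<And>x. norm (poly_op T G x) \<le> norm x * K"
      using bounded_linear.pos_bounded bounded_clinear_poly_op unfolding bounded_clinear_def by blast
    have "cmod (poly Q c) / K * norm x \<le> norm (T x - c *\<^sub>C x)" if "x \<in> M" for x
    proof -
      have "cmod (poly Q c) * norm x = norm (poly_op T (Q - [:poly Q c:]) x)"
        using Q that by (simp add: ann_def poly_op_minus_const norm_scaleC)
      also have "\<dots> = norm (poly_op T G (T x - c *\<^sub>C x))"
        unfolding G poly_op_mult by (simp add: zero scaleC_one complex_vector.scale_minus_left)
      also have "\<dots> \<le> norm (T x - c *\<^sub>C x) * K" by (rule K)
      finally show ?thesis using K(1) by (simp add: field_simps)
    qed
    then show False using nb K(1) Qc unfolding bounded_below_on_def
      by (metis divide_pos_pos zero_less_norm_iff)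
  qed
  then obtain P where P: "Q = [:-c, 1:] * P" by (metis poly_eq_0_iff_dvd dvdE)
  have "P \<noteq> 0" using Q P by (auto simp: ann_def)
  then have "degree P < degree Q" unfolding P by (subst degree_mult_eq) auto
  then have "\<not> ann P" using Qmin by (meson not_le)
  then obtain x where x: "x \<in> M" "poly_op T P x \<noteq> 0" using \<open>P \<noteq> 0\<close> by (auto simp: ann_def)
  \<comment> \<open>By minimality the cofactor \<open>P\<close> does not annihilate
    \<open>M\<close>; what it leaves of \<open>x\<close> is killed by \<open>T - c\<close>, as
    \<open>Q = (X - c) P\<close>.\<close>
  define y where "y = poly_op T P x"
  have "poly_op T [:-c, 1:] y = 0"
    using Q x(1) unfolding ann_def y_def by (subst poly_op_mult[symmetric]) (simp only: P)
  then have Ty: "T y = c *\<^sub>C y" by (simp add: zero scaleC_one complex_vector.scale_minus_left)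
  have y: "y \<in> M" "y \<noteq> 0" using x poly_op_invariant[OF M inv] by (auto simp: y_def)
  show ?thesis unfolding minimum_attaining_on_def
  proof (intro bexI conjI)
    show "norm (T (inverse (norm y) *\<^sub>R y)) = min_modulus_on M T"
      using y Ty by (simp add: scaleR norm_scaleC cm m_def[symmetric])
  qed (use y scale in auto)
qed

end

theorem lemma5p7:
  fixes T :: "'a::complex_hilbert \<Rightarrow> 'a"
  assumes infinite_dim: "\<not> (\<exists>B :: 'a set. finite B \<and> cspan B = UNIV)"
    and separable: "separable_space (euclidean :: 'a topology)"
    and T_bounded: "bounded_clinear T"
    and T_selfadjoint: "selfadjoint T"
    and finite_spectrum: "finite (spectrum T)"
  shows "T \<in> \<M>\<^sub>r"
proof -
  have sym: "cinner (T x) y = cinner x (T y)" for x y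
    using cadjoint_works[OF T_bounded] T_selfadjoint by (simp add: selfadjoint_def)
  obtain Q where "Q \<noteq> 0" "\<And>x. poly_op T Q x = 0"
    using finite_spectrum_imp_algebraic[OF T_bounded sym finite_spectrum] by blast
  \<comment> \<open>One polynomial annihilates the whole space and so serves every reducing subspace
    at once.\<close>
  then show ?thesis
    using algebraic_imp_minimum_attaining_on[OF T_bounded sym] T_bounded
    by (auto simp: reducing_minimum_attaining_def reduces_def)
qed

end
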